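(* Let $G(u)=\sum_P x^{\mathrm{col}(P)}u^{\mathrm{first}(P)}$, summed over all Stanley polyominoes $P$, and let $r=\frac{1-\sqrt{1-4x}}{2x}$, $s=\frac{1+\sqrt{1-4x}}{2x}$. Then \[ G(u)=\frac{u}{r(s-u)}=\frac{\left(2-u-\sqrt{1-4x}\,u\right)xu}{2u^{2}x-2u+2}. \] Moreover, for $n\geq 2$ and $1\leq k\leq n$, \[ [u^k]G(u)=x(rx)^{k-1}\quad\text{and}\quad [x^nu^k]G(u)=\frac{k-1}{2n-k-1}\binom{2n-k-1}{n-k}. \]
   Context: Cells are unit squares $[i,i+1]\times[j,j+1]$ with $i,j\in\mathbb{Z}$. A Stanley polyomino (up to translation) is a set of cells forming $k\geq 1$ rows $0,\dots,k-1$ (bottom to top), row $j$ consisting of the cells with $s_j\le i\le e_j$ ($s_j\le e_j$ integers), such that $s_{j-1}<s_j\le e_{j-1}<e_j$ for $1\le j\le k-1$. Here $\mathrm{col}(P)=e_{k-1}-s_0+1$ is the number of columns and $\mathrm{first}(P)=e_0-s_0+1$ is the number of cells in the first (bottom) row. *)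

theory Defs
  imports "HOL-Computational_Algebra.Computational_Algebra"
begin

text \<open>
  The cell \<open>[i, i+1] \<times> [j, j+1]\<close> is represented by its lower left corner \<open>(i, j)\<close>.
  A list \<open>rs\<close> of pairs of integers describes rows from bottom to top: \<open>rs ! j = (s\<^sub>j, e\<^sub>j)\<close>.
\<close>

definition stanley_rows :: "(int \<times> int) list \<Rightarrow> bool" where
  "stanley_rows rs \<longleftrightarrow> rs \<noteq> [] \<and>
     (\<forall>j < length rs. fst (rs ! j) \<le> snd (rs ! j)) \<and>
     (\<forall>j. 1 \<le> j \<and> j < length rs \<longrightarrow>
        fst (rs ! (j - 1)) < fst (rs ! j) \<and>
        fst (rs ! j) \<le> snd (rs ! (j - 1)) \<and>
        snd (rs ! (j - 1)) < snd (rs ! j))"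

definition cells_of_rows :: "(int \<times> int) list \<Rightarrow> (int \<times> int) set" where
  "cells_of_rows rs = {(i, int j) | i j. j < length rs \<and> fst (rs ! j) \<le> i \<and> i \<le> snd (rs ! j)}"

definition stanley_cell_sets :: "(int \<times> int) set set" where
  "stanley_cell_sets = cells_of_rows ` {rs. stanley_rows rs}"

definition translate :: "int \<Rightarrow> int \<Rightarrow> (int \<times> int) set \<Rightarrow> (int \<times> int) set" where
  "translate a b P = (\<lambda>(i, j). (i + a, j + b)) ` P"

definition translation_rel :: "((int \<times> int) set \<times> (int \<times> int) set) set" where
  "translation_rel = {(P, Q). P \<in> stanley_cell_sets \<and> Q \<in> stanley_cell_sets \<and>
                              (\<exists>a b. Q = translate a b P)}"

definition stanley_polyominoes :: "(int \<times> int) set set set" where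
  "stanley_polyominoes = stanley_cell_sets // translation_rel"

text \<open>
  Both statistics are independent of the representative; see \<open>col_class\<close> and \<open>first_class\<close> below.
\<close>

definition col :: "(int \<times> int) set set \<Rightarrow> nat" where
  "col C = (THE n. \<exists>rs. stanley_rows rs \<and> cells_of_rows rs \<in> C \<and>
                        int n = snd (rs ! (length rs - 1)) - fst (rs ! 0) + 1)"

definition first :: "(int \<times> int) set set \<Rightarrow> nat" where
  "first C = (THE n. \<exists>rs. stanley_rows rs \<and> cells_of_rows rs \<in> C \<and>
                          int n = snd (rs ! 0) - fst (rs ! 0) + 1)"

text \<open>
  The generating function \<open>G(u)\<close>, the sum of \<open>x ^ col P * u ^ first P\<close> over all \<open>P\<close>, is a power series in the outer variable
  \<open>u\<close> (\<open>fps_X\<close>) whose coefficients are series in \<open>x\<close> (\<open>fls_X\<close>). The coefficients are taken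
  to be Laurent series because the closed form involves \<open>(1 + \<surd>(1 - 4x)) / (2x)\<close>.
  The coefficient of \<open>x\<^sup>n u\<^sup>k\<close> is the number of Stanley polyominoes with \<open>col = n\<close>
  and \<open>first = k\<close>, which is finite by \<open>finite_stanley_col_first\<close> below.
\<close>

definition stanley_gf :: "real fls fps" where
  "stanley_gf = Abs_fps (\<lambda>k. fps_to_fls (Abs_fps (\<lambda>n.
      of_nat (card {C \<in> stanley_polyominoes. col C = n \<and> first C = k}))))"

text \<open>
  \<open>\<surd>(1 - 4x)\<close> is the formal square root with constant coefficient \<open>1\<close>.
\<close>

definition sqrt_one_minus_4x :: "real fls" where
  "sqrt_one_minus_4x = fps_to_fls (fps_radical root 2 (1 - 4 * fps_X))"

lemma sqrt_one_minus_4x_square: "sqrt_one_minus_4x ^ 2 = 1 - 4 * fls_X"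
proof -
  have "fps_radical root (Suc 1) (1 - 4 * fps_X :: real fps) ^ Suc 1 = 1 - 4 * fps_X"
    by (subst power_radical [symmetric]) (simp_all add: numeral_2_eq_2 [symmetric])
  hence "fps_radical root 2 (1 - 4 * fps_X :: real fps) ^ 2 = 1 - 4 * fps_X"
    by (simp add: numeral_2_eq_2)
  hence "fps_to_fls (fps_radical root 2 (1 - 4 * fps_X :: real fps) ^ 2) = fps_to_fls (1 - 4 * fps_X)"
    by simp
  thus ?thesis
    by (simp add: sqrt_one_minus_4x_def fps_to_fls_power fls_times_fps_to_fls)
qed

lemma sqrt_one_minus_4x_nth_0: "fls_nth sqrt_one_minus_4x 0 = 1"
  by (simp add: sqrt_one_minus_4x_def numeral_2_eq_2)

lemma equiv_translation_rel: "equiv stanley_cell_sets translation_rel"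
proof (rule equivI)
  show "refl_on stanley_cell_sets translation_rel"
    by (auto simp: refl_on_def translation_rel_def translate_def intro!: exI [of _ 0])
  show "translation_rel \<subseteq> stanley_cell_sets \<times> stanley_cell_sets"
    by (auto simp: translation_rel_def)
  show "sym translation_rel"
  proof (rule symI)
    fix P Q assume "(P, Q) \<in> translation_rel"
    then obtain a b where ab: "P \<in> stanley_cell_sets" "Q \<in> stanley_cell_sets" "Q = translate a b P"
      by (auto simp: translation_rel_def)
    have "P = translate (- a) (- b) Q"
      unfolding ab(3) translate_def by (auto simp: image_image split_def)
    with ab show "(Q, P) \<in> translation_rel" unfolding translation_rel_def by blast
  qed
  show "trans translation_rel"
  proof (rule transI)
    fix P Q R assume "(P, Q) \<in> translation_rel" "(Q, R) \<in> translation_rel"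
    then obtain a b c d where ab: "P \<in> stanley_cell_sets" "R \<in> stanley_cell_sets"
        "Q = translate a b P" "R = translate c d Q"
      unfolding translation_rel_def by blast
    have "R = translate (a + c) (b + d) P"
      unfolding ab(3,4) translate_def by (auto simp: image_image split_def add.assoc)
    with ab show "(P, R) \<in> translation_rel" unfolding translation_rel_def by blast
  qed
qed

lemma mem_cells_of_rows:
  "(i, j) \<in> cells_of_rows rs \<longleftrightarrow>
     0 \<le> j \<and> nat j < length rs \<and> fst (rs ! nat j) \<le> i \<and> i \<le> snd (rs ! nat j)"
proof
  assume "0 \<le> j \<and> nat j < length rs \<and> fst (rs ! nat j) \<le> i \<and> i \<le> snd (rs ! nat j)"
  thus "(i, j) \<in> cells_of_rows rs"
    unfolding cells_of_rows_def by (auto intro!: exI [of _ "nat j"])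
qed (auto simp: cells_of_rows_def)

lemma mem_translate: "(i, j) \<in> translate a b P \<longleftrightarrow> (i - a, j - b) \<in> P"
  unfolding translate_def by force

lemma row_nonempty:
  assumes "stanley_rows rs" "j < length rs"
  shows "(fst (rs ! j), int j) \<in> cells_of_rows rs"
  using assms by (auto simp: mem_cells_of_rows stanley_rows_def)

lemma translate_rows_eqD:
  assumes st: "stanley_rows rs" "stanley_rows rs'"
    and eq: "cells_of_rows rs' = translate a b (cells_of_rows rs)"
  shows "length rs' = length rs"
    and "j < length rs \<Longrightarrow> rs' ! j = (fst (rs ! j) + a, snd (rs ! j) + a)"
proof -
  have mem: "(i, j) \<in> cells_of_rows rs' \<longleftrightarrow> (i - a, j - b) \<in> cells_of_rows rs" for i j
    unfolding eq mem_translate ..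
  have ne: "0 < length rs" "0 < length rs'"
    using st by (auto simp: stanley_rows_def)
  have "b \<ge> 0"
    using row_nonempty [OF st(1) ne(1)] mem [of "fst (rs ! 0) + a" b] by (simp add: mem_cells_of_rows)
  moreover have "b \<le> 0"
    using row_nonempty [OF st(2) ne(2)] mem [of "fst (rs' ! 0)" 0] by (simp add: mem_cells_of_rows)
  ultimately have b: "b = 0" by simp
  have "j < length rs" if "j < length rs'" for j
    using row_nonempty [OF st(2) that] by (simp add: mem b) (simp add: mem_cells_of_rows)
  moreover have "j < length rs'" if "j < length rs" for j
    using row_nonempty [OF st(1) that] mem [of "fst (rs ! j) + a" "int j"]
    by (simp add: b) (simp add: mem_cells_of_rows)
  ultimately show len: "length rs' = length rs"
    by (meson linorder_neqE_nat less_irrefl)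
  show "rs' ! j = (fst (rs ! j) + a, snd (rs ! j) + a)" if j: "j < length rs"
  proof -
    have iff: "fst (rs' ! j) \<le> i \<and> i \<le> snd (rs' ! j) \<longleftrightarrow>
               fst (rs ! j) + a \<le> i \<and> i \<le> snd (rs ! j) + a" for i
      using mem [of i "int j"] j len by (auto simp: b mem_cells_of_rows)
    have "fst (rs ! j) \<le> snd (rs ! j)" "fst (rs' ! j) \<le> snd (rs' ! j)"
      using st j len by (auto simp: stanley_rows_def)
    hence "fst (rs' ! j) = fst (rs ! j) + a" "snd (rs' ! j) = snd (rs ! j) + a"
      using iff [of "fst (rs' ! j)"] iff [of "snd (rs' ! j)"]
        iff [of "fst (rs ! j) + a"] iff [of "snd (rs ! j) + a"] by auto
    thus ?thesis by (simp add: prod_eq_iff)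
  qed
qed

lemma stanley_rows_fst_ge:
  assumes "stanley_rows rs" "j < length rs"
  shows "fst (rs ! 0) + int j \<le> fst (rs ! j)"
  using assms(2)
proof (induction j)
  case (Suc j)
  have "fst (rs ! j) < fst (rs ! Suc j)"
    using assms(1) Suc.prems unfolding stanley_rows_def by (metis One_nat_def Suc_le_mono diff_Suc_1 le0)
  with Suc show ?case by simp
qed simp

lemma stanley_rows_snd_le:
  assumes "stanley_rows rs" "j < length rs"
  shows "snd (rs ! j) \<le> snd (rs ! (length rs - 1))"
proof -
  have "j + d < length rs \<Longrightarrow> snd (rs ! j) \<le> snd (rs ! (j + d))" for d
  proof (induction d)
    case (Suc d)
    have "snd (rs ! (j + d)) < snd (rs ! Suc (j + d))"
      using assms(1) Suc.prems unfolding stanley_rows_def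
      by (metis One_nat_def Suc_le_mono add_Suc_right diff_Suc_1 le0)
    with Suc show ?case by simp
  qed simp
  from this [of "length rs - 1 - j"] assms(2) show ?thesis by simp
qed

lemma stanley_rows_col_pos:
  assumes "stanley_rows rs"
  shows "snd (rs ! (length rs - 1)) - fst (rs ! 0) + 1 \<ge> 1" "snd (rs ! 0) - fst (rs ! 0) + 1 \<ge> 1"
proof -
  have "0 < length rs" "fst (rs ! 0) \<le> snd (rs ! 0)"
    using assms by (auto simp: stanley_rows_def)
  with stanley_rows_snd_le [OF assms, of 0]
  show "snd (rs ! (length rs - 1)) - fst (rs ! 0) + 1 \<ge> 1" "snd (rs ! 0) - fst (rs ! 0) + 1 \<ge> 1"
    by auto
qed

lemma class_memD:
  assumes "stanley_rows rs" "stanley_rows rs'" "cells_of_rows rs' \<in> translation_rel `` {cells_of_rows rs}"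
  obtains a where "length rs' = length rs"
    "\<And>j. j < length rs \<Longrightarrow> rs' ! j = (fst (rs ! j) + a, snd (rs ! j) + a)"
  using assms(3) translate_rows_eqD [OF assms(1,2)] unfolding translation_rel_def by blast

lemma self_in_class:
  assumes "stanley_rows rs"
  shows "cells_of_rows rs \<in> translation_rel `` {cells_of_rows rs}"
  using equiv_class_self [OF equiv_translation_rel] assms by (auto simp: stanley_cell_sets_def)

lemma col_class:
  assumes "stanley_rows rs"
  shows "int (col (translation_rel `` {cells_of_rows rs})) =
           snd (rs ! (length rs - 1)) - fst (rs ! 0) + 1"
proof -
  have "col (translation_rel `` {cells_of_rows rs}) =
          nat (snd (rs ! (length rs - 1)) - fst (rs ! 0) + 1)"
    unfolding col_def
  proof (rule the_equality)
    show "\<exists>rs'. stanley_rows rs' \<and> cells_of_rows rs' \<in> translation_rel `` {cells_of_rows rs} \<and>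
            int (nat (snd (rs ! (length rs - 1)) - fst (rs ! 0) + 1)) =
            snd (rs' ! (length rs' - 1)) - fst (rs' ! 0) + 1"
      using assms self_in_class stanley_rows_col_pos(1) [OF assms] by (intro exI [of _ rs]) auto
  next
    fix n assume "\<exists>rs'. stanley_rows rs' \<and> cells_of_rows rs' \<in> translation_rel `` {cells_of_rows rs} \<and>
            int n = snd (rs' ! (length rs' - 1)) - fst (rs' ! 0) + 1"
    then obtain rs' where rs': "stanley_rows rs'" "int n = snd (rs' ! (length rs' - 1)) - fst (rs' ! 0) + 1"
      "cells_of_rows rs' \<in> translation_rel `` {cells_of_rows rs}" by blast
    obtain a where a: "length rs' = length rs"
        "\<And>j. j < length rs \<Longrightarrow> rs' ! j = (fst (rs ! j) + a, snd (rs ! j) + a)"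
      using class_memD [OF assms rs'(1,3)] by blast
    have "0 < length rs" using assms by (auto simp: stanley_rows_def)
    thus "n = nat (snd (rs ! (length rs - 1)) - fst (rs ! 0) + 1)"
      using rs'(2) a by simp
  qed
  with stanley_rows_col_pos(1) [OF assms] show ?thesis by simp
qed

lemma first_class:
  assumes "stanley_rows rs"
  shows "int (first (translation_rel `` {cells_of_rows rs})) = snd (rs ! 0) - fst (rs ! 0) + 1"
proof -
  have "first (translation_rel `` {cells_of_rows rs}) = nat (snd (rs ! 0) - fst (rs ! 0) + 1)"
    unfolding first_def
  proof (rule the_equality)
    show "\<exists>rs'. stanley_rows rs' \<and> cells_of_rows rs' \<in> translation_rel `` {cells_of_rows rs} \<and>
            int (nat (snd (rs ! 0) - fst (rs ! 0) + 1)) = snd (rs' ! 0) - fst (rs' ! 0) + 1"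
      using assms self_in_class stanley_rows_col_pos(2) [OF assms] by (intro exI [of _ rs]) auto
  next
    fix n assume "\<exists>rs'. stanley_rows rs' \<and> cells_of_rows rs' \<in> translation_rel `` {cells_of_rows rs} \<and>
            int n = snd (rs' ! 0) - fst (rs' ! 0) + 1"
    then obtain rs' where rs': "stanley_rows rs'" "int n = snd (rs' ! 0) - fst (rs' ! 0) + 1"
      "cells_of_rows rs' \<in> translation_rel `` {cells_of_rows rs}" by blast
    obtain a where a: "length rs' = length rs"
        "\<And>j. j < length rs \<Longrightarrow> rs' ! j = (fst (rs ! j) + a, snd (rs ! j) + a)"
      using class_memD [OF assms rs'(1,3)] by blast
    have "0 < length rs" using assms by (auto simp: stanley_rows_def)
    thus "n = nat (snd (rs ! 0) - fst (rs ! 0) + 1)"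
      using rs'(2) a by simp
  qed
  with stanley_rows_col_pos(2) [OF assms] show ?thesis by simp
qed

lemma stanley_rows_shift:
  assumes "stanley_rows rs"
  shows "stanley_rows (map (\<lambda>(s, e). (s + a, e + a)) rs)"
    and "cells_of_rows (map (\<lambda>(s, e). (s + a, e + a)) rs) = translate a 0 (cells_of_rows rs)"
proof -
  show "stanley_rows (map (\<lambda>(s, e). (s + a, e + a)) rs)"
    using assms unfolding stanley_rows_def by (auto simp: split_def less_imp_diff_less)
  have "(i, j) \<in> cells_of_rows (map (\<lambda>(s, e). (s + a, e + a)) rs) \<longleftrightarrow>
          (i, j) \<in> translate a 0 (cells_of_rows rs)" for i j
    unfolding mem_cells_of_rows mem_translate
    by (cases "nat j < length rs") (auto simp: split_def)
  thus "cells_of_rows (map (\<lambda>(s, e). (s + a, e + a)) rs) = translate a 0 (cells_of_rows rs)"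
    by auto
qed

lemma finite_stanley_col: "finite {C \<in> stanley_polyominoes. col C = n}"
proof (rule finite_subset)
  let ?A = "{rs. set rs \<subseteq> {0..int n} \<times> {0..int n} \<and> length rs \<le> n}"
  show "finite ((\<lambda>rs. translation_rel `` {cells_of_rows rs}) ` ?A)"
    by (intro finite_imageI finite_lists_length_le) auto
  show "{C \<in> stanley_polyominoes. col C = n} \<subseteq> (\<lambda>rs. translation_rel `` {cells_of_rows rs}) ` ?A"
  proof clarify
    fix C assume C: "C \<in> stanley_polyominoes" "n = col C"
    then obtain rs where rs: "stanley_rows rs" "C = translation_rel `` {cells_of_rows rs}"
      by (auto simp: stanley_polyominoes_def stanley_cell_sets_def elim!: quotientE)
    define rs' where "rs' = map (\<lambda>(s, e). (s + - fst (rs ! 0), e + - fst (rs ! 0))) rs"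
    have rs': "stanley_rows rs'" "cells_of_rows rs' = translate (- fst (rs ! 0)) 0 (cells_of_rows rs)"
      unfolding rs'_def using stanley_rows_shift [OF rs(1)] by blast+
    have "(cells_of_rows rs, cells_of_rows rs') \<in> translation_rel"
      using rs rs' by (auto simp: translation_rel_def stanley_cell_sets_def)
    hence C': "C = translation_rel `` {cells_of_rows rs'}"
      using rs(2) equiv_class_eq [OF equiv_translation_rel] by simp
    have len: "0 < length rs'" using rs'(1) by (auto simp: stanley_rows_def)
    have z: "fst (rs' ! 0) = 0"
      using len unfolding rs'_def by (simp add: split_def)
    have n: "int n = snd (rs' ! (length rs' - 1)) + 1"
      using col_class [OF rs'(1)] C(2) C' z by simp
    have bd: "int j \<le> fst (rs' ! j)" "fst (rs' ! j) \<le> snd (rs' ! j)" "snd (rs' ! j) \<le> int n - 1"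
      if "j < length rs'" for j
      using stanley_rows_fst_ge [OF rs'(1) that] stanley_rows_snd_le [OF rs'(1) that] rs'(1) that z n
      by (auto simp: stanley_rows_def)
    have "set rs' \<subseteq> {0..int n} \<times> {0..int n}"
    proof
      fix p assume "p \<in> set rs'"
      then obtain j where "j < length rs'" "p = rs' ! j" by (auto simp: in_set_conv_nth)
      with bd [of j] show "p \<in> {0..int n} \<times> {0..int n}"
        by (auto simp: mem_Times_iff)
    qed
    moreover have "length rs' \<le> n"
      using bd [of "length rs' - 1"] len by linarith
    ultimately show "C \<in> (\<lambda>rs. translation_rel `` {cells_of_rows rs}) `
        {rs. set rs \<subseteq> {0..int (col C)} \<times> {0..int (col C)} \<and> length rs \<le> col C}"
      using C' C(2) by blast
  qed
qed

lemma finite_stanley_col_first: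
  "finite {C \<in> stanley_polyominoes. col C = n \<and> first C = k}"
  by (rule finite_subset [OF _ finite_stanley_col [of n]]) auto

end

theory Submission
  imports Defs
begin

text \<open>
  The leftmost column of a Stanley polyomino is a single cell of the bottom row. Deleting that
  cell from a polyomino with \<open>n + 1\<close> columns and \<open>k + 1 \<ge> 2\<close> cells in the bottom row either
  leaves a Stanley polyomino with \<open>k\<close> cells in the bottom row, or makes the first two rows start in
  the same column; in the latter case deleting the whole bottom row leaves a Stanley polyomino whose
  bottom row has more than \<open>k\<close> cells. Hence \<open>a(n + 1, k + 1) = (\<Sum>m \<ge> k. a(n, m))\<close>, equivalently
  \<open>a(n + 1, k + 1) = a(n, k) + a(n + 1, k + 2)\<close>. As \<open>w = r x\<close> solves \<open>w = x + w\<^sup>2\<close>, the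
  coefficients of \<open>x w\<^bsup>k-1\<^esup>\<close> satisfy this recurrence with the same boundary values, and so do the
  ballot numbers in the statement.
\<close>

section \<open>Row lists and anchored representatives of translation classes\<close>

lemma stanley_rows_Cons:
  "stanley_rows (p # rs) \<longleftrightarrow> fst p \<le> snd p \<and>
     (rs = [] \<or> stanley_rows rs \<and> fst p < fst (hd rs) \<and> fst (hd rs) \<le> snd p \<and> snd p < snd (hd rs))"
proof (cases rs)
  case Nil
  then show ?thesis by (auto simp: stanley_rows_def)
next
  case (Cons q t)
  have shift: "(\<forall>j. 1 \<le> j \<and> j < Suc m \<longrightarrow> P j) \<longleftrightarrow> (\<forall>j < m. P (Suc j))" for P and m :: nat
    using less_Suc_eq_0_disj by auto
  show ?thesis
    unfolding stanley_rows_def Cons list.size add_0_right add_Suc_right shift All_less_Suc2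
    by auto
qed

text \<open>
  Translation classes are represented by the row lists whose last column has index \<open>0\<close>; this
  normalisation is not affected by removing columns on the left or rows at the bottom.
\<close>

definition anchored_rows :: "nat \<Rightarrow> nat \<Rightarrow> (int \<times> int) list set" where
  "anchored_rows n k =
     {rs. stanley_rows rs \<and> snd (last rs) = 0 \<and> hd rs = (1 - int n, int k - int n)}"

text \<open>Translates with equal statistics differ by a horizontal shift \<open>a\<close> alone,
  and since both bottom rows start in column \<open>1 - int n\<close>, \<open>a = 0\<close>.
  Conversely, any representative is anchored by shifting its last column to 0.\<close>

lemma anchored_rows_bij_betw:
  "bij_betw (\<lambda>rs. translation_rel `` {cells_of_rows rs}) (anchored_rows n k)
     {C \<in> stanley_polyominoes. col C = n \<and> first C = k}"
proof (rule bij_betw_imageI)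
  let ?f = "\<lambda>rs. translation_rel `` {cells_of_rows rs}"
  show "inj_on ?f (anchored_rows n k)"
  proof (rule inj_onI)
    fix rs rs' assume rs: "rs \<in> anchored_rows n k" "rs' \<in> anchored_rows n k" "?f rs = ?f rs'"
    then have st: "stanley_rows rs" "stanley_rows rs'" and ne: "rs \<noteq> []" "rs' \<noteq> []"
      by (auto simp: anchored_rows_def stanley_rows_def)
    obtain a where a: "length rs' = length rs"
        "\<And>j. j < length rs \<Longrightarrow> rs' ! j = (fst (rs ! j) + a, snd (rs ! j) + a)"
      using class_memD [OF st] self_in_class [OF st(2)] rs(3) by metis
    have "hd rs' = (fst (hd rs) + a, snd (hd rs) + a)"
      using a(2) [of 0] ne by (simp add: hd_conv_nth)
    then have "a = 0"
      using rs(1,2) by (simp add: anchored_rows_def)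
    with a show "rs = rs'"
      by (intro nth_equalityI) auto
  qed
  show "?f ` anchored_rows n k = {C \<in> stanley_polyominoes. col C = n \<and> first C = k}"
  proof (intro equalityI subsetI)
    fix C assume "C \<in> ?f ` anchored_rows n k"
    then obtain rs where rs: "rs \<in> anchored_rows n k" "C = ?f rs" by blast
    then have st: "stanley_rows rs" and ne: "rs \<noteq> []"
      by (auto simp: anchored_rows_def stanley_rows_def)
    have "C \<in> stanley_polyominoes"
      unfolding rs(2) stanley_polyominoes_def stanley_cell_sets_def using st by (auto intro!: quotientI)
    moreover have "int (col C) = int n" "int (first C) = int k"
      using rs col_class [OF st] first_class [OF st] ne
      by (auto simp: anchored_rows_def last_conv_nth hd_conv_nth)
    ultimately show "C \<in> {C \<in> stanley_polyominoes. col C = n \<and> first C = k}" by simp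
  next
    fix C assume C: "C \<in> {C \<in> stanley_polyominoes. col C = n \<and> first C = k}"
    then obtain rs where rs: "stanley_rows rs" "C = ?f rs"
      by (auto simp: stanley_polyominoes_def stanley_cell_sets_def elim!: quotientE)
    define a where "a = - snd (last rs)"
    define rs' where "rs' = map (\<lambda>(s, e). (s + a, e + a)) rs"
    have rs': "stanley_rows rs'" "cells_of_rows rs' = translate a 0 (cells_of_rows rs)"
      unfolding rs'_def using stanley_rows_shift [OF rs(1)] by blast+
    have "(cells_of_rows rs, cells_of_rows rs') \<in> translation_rel"
      using rs rs' by (auto simp: translation_rel_def stanley_cell_sets_def)
    then have C': "C = ?f rs'"
      using rs(2) equiv_class_eq [OF equiv_translation_rel] by simp
    have ne: "rs \<noteq> []" "rs' \<noteq> []" using rs(1) rs'(1) by (auto simp: stanley_rows_def)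
    have last: "snd (last rs') = 0"
      using ne by (simp add: rs'_def last_map a_def split_def)
    have "int n = snd (last rs') - fst (hd rs') + 1" "int k = snd (hd rs') - fst (hd rs') + 1"
      using C C' col_class [OF rs'(1)] first_class [OF rs'(1)] ne
      by (auto simp: last_conv_nth hd_conv_nth)
    with last have "rs' \<in> anchored_rows n k"
      using rs'(1) by (simp add: anchored_rows_def prod_eq_iff)
    with C' show "C \<in> ?f ` anchored_rows n k" by blast
  qed
qed

lemma finite_anchored_rows: "finite (anchored_rows n k)"
  using bij_betw_finite [OF anchored_rows_bij_betw] finite_stanley_col_first by blast

section \<open>Counting anchored row lists by removing the leftmost cell\<close>

lemma anchored_rows_eq_empty:
  assumes "n < k"
  shows "anchored_rows n k = {}"
proof -
  have False if "rs \<in> anchored_rows n k" for rs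
  proof -
    have st: "stanley_rows rs" "rs \<noteq> []" "snd (last rs) = 0" "hd rs = (1 - int n, int k - int n)"
      using that by (auto simp: anchored_rows_def stanley_rows_def)
    then show False
      using stanley_rows_snd_le [OF st(1), of 0] assms by (simp add: last_conv_nth flip: hd_conv_nth)
  qed
  then show ?thesis by blast
qed

text \<open>A second row would have to start strictly to the right of the only cell of the bottom
  row and still overlap that row, so there is a single row.\<close>

lemma anchored_rows_1: "anchored_rows n 1 = (if n = 1 then {[(0, 0)]} else {})"
proof -
  have "rs \<in> anchored_rows n 1 \<longleftrightarrow> n = 1 \<and> rs = [(0, 0)]" for rs
    by (cases rs) (auto simp: anchored_rows_def stanley_rows_Cons stanley_rows_def [of "[]"])
  then show ?thesis by auto
qed

text \<open>The map \<open>?f\<close> extends the bottom row by one cell to the left;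
  \<open>?g\<close> inserts a new bottom row starting one column earlier. That row must end before
  the row above it, whence \<open>k < m\<close>; with \<open>k \<ge> 1\<close> it reaches the first
  column of that row.\<close>

lemma anchored_rows_Suc_Suc:
  assumes "k \<ge> 1"
  shows "anchored_rows (Suc n) (Suc k) =
           (\<lambda>rs. (- int n, int k - int n) # tl rs) ` anchored_rows n k \<union>
           (\<lambda>rs. (- int n, int k - int n) # rs) ` (\<Union>m \<in> {k<..n}. anchored_rows n m)"
    (is "_ = ?f ` _ \<union> ?g ` _")
proof (intro equalityI subsetI)
  fix rs assume rs: "rs \<in> anchored_rows (Suc n) (Suc k)"
  then obtain t where t: "rs = (- int n, int k - int n) # t"
    by (cases rs) (auto simp: anchored_rows_def stanley_rows_def)
  have st: "stanley_rows rs" and last: "snd (last rs) = 0"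
    using rs by (auto simp: anchored_rows_def)
  show "rs \<in> ?f ` anchored_rows n k \<union> ?g ` (\<Union>m \<in> {k<..n}. anchored_rows n m)"
  \<comment> \<open>If the second row starts right next to the leftmost column, dropping the
    leftmost cell would make two left ends equal, so the whole bottom row goes.\<close>
  proof (cases "t \<noteq> [] \<and> fst (hd t) = 1 - int n")
    case True
    define m where "m = nat (snd (hd t) + int n)"
    have "stanley_rows t" "int k - int n < snd (hd t)"
      using st True by (auto simp: t stanley_rows_Cons)
    then have m: "k < m" "t \<in> anchored_rows n m"
      using True last by (auto simp: m_def anchored_rows_def t prod_eq_iff)
    then have "m \<le> n" using anchored_rows_eq_empty [of n m] by force
    with m have "t \<in> (\<Union>m \<in> {k<..n}. anchored_rows n m)" by auto
    then show ?thesis unfolding t by (intro UnI2 imageI)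
  next
    case False
    have "(1 - int n, int k - int n) # t \<in> anchored_rows n k"
      using st last assms False by (auto simp: t anchored_rows_def stanley_rows_Cons)
    then have "?f ((1 - int n, int k - int n) # t) \<in> ?f ` anchored_rows n k" by (rule imageI)
    then show ?thesis by (simp add: t)
  qed
next
  fix rs assume "rs \<in> ?f ` anchored_rows n k \<union> ?g ` (\<Union>m \<in> {k<..n}. anchored_rows n m)"
  then consider t where "t \<in> anchored_rows n k" "rs = ?f t"
    | t m where "k < m" "t \<in> anchored_rows n m" "rs = ?g t" by auto
  then show "rs \<in> anchored_rows (Suc n) (Suc k)"
  proof cases
    case 1
    then show ?thesis
      by (cases t) (auto simp: anchored_rows_def stanley_rows_Cons stanley_rows_def [of "[]"])
  next
    case 2
    then have "t \<noteq> []" by (auto simp: anchored_rows_def stanley_rows_def)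
    with 2 assms show ?thesis
      by (auto simp: anchored_rows_def stanley_rows_Cons)
  qed
qed

lemma card_anchored_rows_Suc_Suc:
  assumes "k \<ge> 1"
  shows "card (anchored_rows (Suc n) (Suc k)) = (\<Sum>m = k..n. card (anchored_rows n m))"
proof -
  let ?f = "\<lambda>rs. (- int n, int k - int n) # tl rs"
  let ?g = "\<lambda>rs. (- int n, int k - int n) # rs"
  let ?U = "\<Union>m \<in> {k<..n}. anchored_rows n m"
  have cons: "\<exists>t. rs = (1 - int n, int m - int n) # t" if "rs \<in> anchored_rows n m" for rs m
    using that by (cases rs) (auto simp: anchored_rows_def stanley_rows_def)
  have "inj_on ?f (anchored_rows n k)"
  proof (rule inj_onI)
    fix t t' assume "t \<in> anchored_rows n k" "t' \<in> anchored_rows n k" "?f t = ?f t'"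
    with cons [of t k] cons [of t' k] show "t = t'" by auto
  qed
  moreover have "inj_on ?g ?U" by (auto intro: inj_onI)
  moreover have "?f ` anchored_rows n k \<inter> ?g ` ?U = {}"
  \<comment> \<open>A common element would be \<open>?f t = ?g (tl t)\<close>, where the first two
    rows of \<open>t\<close> both start in column \<open>1 - int n\<close>, against strict increase
    of left ends.\<close>
  proof -
    have False if "t \<in> anchored_rows n k" "tl t \<in> anchored_rows n m" for t m
      using cons [OF that(1)] cons [OF that(2)] that(1)
      by (auto simp: anchored_rows_def stanley_rows_Cons)
    then show ?thesis by blast
  qed
  ultimately have "card (anchored_rows (Suc n) (Suc k)) = card (anchored_rows n k) + card ?U"
    unfolding anchored_rows_Suc_Suc [OF assms]
    by (subst card_Un_disjoint) (auto simp: finite_anchored_rows card_image)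
  also have "card ?U = (\<Sum>m \<in> {k<..n}. card (anchored_rows n m))"
    by (rule card_UN_disjoint) (simp_all add: finite_anchored_rows, auto simp: anchored_rows_def)
  also have "card (anchored_rows n k) + \<dots> = (\<Sum>m = k..n. card (anchored_rows n m))"
    by (cases "k \<le> n") (auto simp: sum.head anchored_rows_eq_empty)
  finally show ?thesis .
qed

text \<open>The sums for \<open>k\<close> and \<open>Suc k\<close> differ only in the term
  \<open>m = k\<close>.\<close>

lemma card_anchored_rows_rec:
  assumes "k \<ge> 1"
  shows "card (anchored_rows (Suc n) (Suc k)) =
           card (anchored_rows n k) + card (anchored_rows (Suc n) (Suc (Suc k)))"
  using assms card_anchored_rows_Suc_Suc [of k n] card_anchored_rows_Suc_Suc [of "Suc k" n]
  by (cases "k \<le> n") (auto simp: sum.atLeast_Suc_atMost anchored_rows_eq_empty)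

section \<open>The ballot recurrence and its uniqueness\<close>

locale ballot_recurrence =
  fixes f :: "nat \<Rightarrow> nat \<Rightarrow> real"
  assumes above_diagonal: "n < k \<Longrightarrow> f n k = 0"
    and column_1: "f n 1 = (if n = 1 then 1 else 0)"
    and rec: "k \<ge> 1 \<Longrightarrow> f (Suc n) (Suc k) = f n k + f (Suc n) (Suc (Suc k))"

text \<open>The recurrence refers to the previous row and to a larger \<open>k\<close> in the same
  row: hence induction on \<open>n\<close>, and within a row downward from the diagonal. Column 0 is
  left free by the locale, so agreement is claimed for \<open>k \<ge> 1\<close>.\<close>

lemma ballot_recurrence_unique:
  assumes "ballot_recurrence f" "ballot_recurrence g" "k \<ge> 1"
  shows "f n k = g n k"
  using assms(3)
proof (induction n arbitrary: k)
  case 0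
  then show ?case using assms(1,2) by (simp add: ballot_recurrence.above_diagonal)
next
  case (Suc n)
  show ?case
  proof (cases "k \<le> Suc n")
    case True
    then show ?thesis using Suc.prems
    proof (induction k rule: inc_induct)
      \<comment> \<open>On the diagonal the second term of the recurrence vanishes; the corner
        \<open>n = 0\<close> of this case is fixed by column 1 instead.\<close>
      case base
      show ?case
      proof (cases n)
        case 0
        then show ?thesis using assms(1,2) ballot_recurrence.column_1 by (metis One_nat_def)
      next
        case (Suc m)
        then have "n \<ge> 1" by simp
        then show ?thesis
          using Suc.IH [of n] assms(1,2) [THEN ballot_recurrence.rec, of n n]
            assms(1,2) [THEN ballot_recurrence.above_diagonal, of "Suc n" "Suc (Suc n)"] by simp
      qed
    next
      case (step k)
      show ?case
      proof (cases "k = 1")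
        case True
        then show ?thesis using assms(1,2) ballot_recurrence.column_1 by metis
      next
        case False
        then obtain j where "k = Suc j" "j \<ge> 1" using step.prems by (cases k) auto
        then show ?thesis
          using Suc.IH [of j] step assms(1,2) [THEN ballot_recurrence.rec, of j n] by simp
      qed
    qed
  next
    case False
    then show ?thesis using assms(1,2) by (simp add: ballot_recurrence.above_diagonal)
  qed
qed

section \<open>Three solutions: the counts, the power series coefficients, the ballot
  numbers\<close>

lemma ballot_recurrence_card: "ballot_recurrence (\<lambda>n k. real (card (anchored_rows n k)))"
proof
  show "real (card (anchored_rows n 1)) = (if n = 1 then 1 else 0)" for n
    by (simp only: anchored_rows_1) simp
next
  fix k n :: nat assume "k \<ge> 1"
  then show "real (card (anchored_rows (Suc n) (Suc k))) =
      real (card (anchored_rows n k)) + real (card (anchored_rows (Suc n) (Suc (Suc k))))"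
    by (metis card_anchored_rows_rec of_nat_add)
qed (simp add: anchored_rows_eq_empty)

text \<open>Multiplying the equation for \<open>w\<close> by \<open>fps_X * w ^ (k - 1)\<close>
  gives the recurrence. As \<open>w\<close> has no constant term, \<open>fps_X * w ^ (k - 1)\<close>
  has no terms below degree \<open>k\<close>.\<close>

lemma ballot_recurrence_fps:
  fixes w :: "real fps"
  assumes "w = fps_X + w ^ 2" "fps_nth w 0 = 0"
  shows "ballot_recurrence (\<lambda>n k. fps_nth (fps_X * w ^ (k - 1)) n)"
proof
  show "fps_nth (fps_X * w ^ (k - 1)) n = 0" if "n < k" for n k
    using that assms(2) by (cases n) (auto intro!: startsby_zero_power_prefix[rule_format])
next
  show "fps_nth (fps_X * w ^ (1 - 1)) n = (if n = 1 then 1 else 0)" for n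
    by (auto simp: fps_X_def)
next
  fix k n :: nat assume k: "k \<ge> 1"
  have "fps_X * w ^ k = fps_X * (w ^ (k - 1) * w)"
    using k by (simp flip: power_Suc2)
  also have "\<dots> = fps_X * (w ^ (k - 1) * (fps_X + w ^ 2))"
    by (subst (2) assms(1)) simp
  also have "w ^ (k - 1) * w ^ 2 = w ^ Suc k"
    using k by (simp flip: power_add)
  then have "fps_X * (w ^ (k - 1) * (fps_X + w ^ 2)) = fps_X * (fps_X * w ^ (k - 1)) + fps_X * w ^ Suc k"
    by (simp add: algebra_simps)
  finally have "fps_nth (fps_X * w ^ k) (Suc n) =
      fps_nth (fps_X * (fps_X * w ^ (k - 1)) + fps_X * w ^ Suc k) (Suc n)" by (rule arg_cong)
  then show "fps_nth (fps_X * w ^ (Suc k - 1)) (Suc n) =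
      fps_nth (fps_X * w ^ (k - 1)) n + fps_nth (fps_X * w ^ (Suc (Suc k) - 1)) (Suc n)"
    by (simp del: power_Suc)
qed

text \<open>The fraction uses real subtraction, while the binomial arguments use truncated
  subtraction, which is exact for \<open>1 \<le> k \<le> n\<close>.\<close>

definition ballot_number :: "nat \<Rightarrow> nat \<Rightarrow> real" where
  "ballot_number n k = (real k - 1) / (2 * real n - real k - 1) * real ((2 * n - k - 1) choose (n - k))"

lemma ballot_number_diagonal: "n \<ge> 2 \<Longrightarrow> ballot_number n n = 1"
  by (simp add: ballot_number_def)

text \<open>Absorption identities turn all three binomials into multiples of
  \<open>N choose Suc j\<close>, with \<open>N = 2 * n - k - 1\<close>; what remains is a rational
  identity.\<close>

lemma ballot_number_rec:
  assumes "1 \<le> k" "k < n"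
  shows "ballot_number (Suc n) (Suc k) = ballot_number n k + ballot_number (Suc n) (Suc (Suc k))"
proof -
  define j where "j = n - k - 1"
  define N where "N = n + j"
  have n: "n = Suc (j + k)" using assms by (simp add: j_def)
  have pos: "real n > 0" "real N > 0" by (simp_all add: N_def n)
  have idx: "2 * Suc n - Suc k - 1 = Suc N" "2 * n - k - 1 = N" "2 * Suc n - Suc (Suc k) - 1 = N"
      "Suc n - Suc k = Suc j" "n - k = Suc j" "Suc n - Suc (Suc k) = j"
      "2 * real (Suc n) - real (Suc k) - 1 = real N + 1" "2 * real n - real k - 1 = real N"
      "2 * real (Suc n) - real (Suc (Suc k)) - 1 = real N"
    by (simp_all add: N_def n)
  have "Suc j * (N choose Suc j) = n * (N choose j)"
    using binomial_absorb_comp [of N j] binomial_absorption [of j N] by (simp add: N_def)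
  then have "real n * real (N choose j) = (real j + 1) * real (N choose Suc j)"
    by (metis of_nat_mult of_nat_Suc add.commute)
  then have B: "real (N choose j) = (real j + 1) / real n * real (N choose Suc j)"
    using pos(1) by (simp add: field_simps)
  have "n * (Suc N choose Suc j) = Suc N * (N choose Suc j)"
    using binomial_absorb_comp [of "Suc N" "Suc j"] by (simp add: N_def)
  then have "real n * real (Suc N choose Suc j) = (real N + 1) * real (N choose Suc j)"
    by (metis of_nat_mult of_nat_Suc add.commute)
  then have A: "real (Suc N choose Suc j) = (real N + 1) / real n * real (N choose Suc j)"
    using pos(1) by (simp add: field_simps del: binomial_Suc_Suc)
  \<comment> \<open>This is the recurrence with the common binomial cancelled and denominators
    cleared.\<close>
  have kN: "real k * real N = (real k - 1) * real n + (real k + 1) * (real j + 1)"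
    by (simp add: n N_def algebra_simps)
  have "real k / (real N + 1) * real (Suc N choose Suc j) = real k / real n * real (N choose Suc j)"
    unfolding A using pos(1) by simp
  also have "real k / real n = ((real k - 1) * real n + (real k + 1) * (real j + 1)) / (real N * real n)"
    using kN pos(1,2) by (simp add: field_simps)
  also have "\<dots> * real (N choose Suc j) =
      (real k - 1) / real N * real (N choose Suc j) + (real k + 1) / real N * real (N choose j)"
    unfolding B using pos(1,2) by (simp add: field_simps)
  finally show ?thesis
    unfolding ballot_number_def idx by simp
qed

text \<open>At \<open>n = k = 1\<close> the formula is \<open>0 / 0\<close>, evaluated as 0, whereas
  the recurrence demands 1; hence the separate value for \<open>n = 1\<close>.\<close>

lemma ballot_recurrence_ballot_number:
  "ballot_recurrence (\<lambda>n k. if n < k then 0 else if n = 1 then 1 else ballot_number n k)"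
proof
  show "(if n < 1 then 0 else if n = 1 then 1 else ballot_number n 1) = (if n = 1 then 1 else 0)" for n
    by (simp add: ballot_number_def)
next
  fix k n :: nat assume k: "k \<ge> 1"
  consider "n < k" | "n = k" "n = 1" | "n = k" "n \<ge> 2" | "k < n" using k by linarith
  then show "(if Suc n < Suc k then 0 else if Suc n = 1 then 1 else ballot_number (Suc n) (Suc k)) =
      (if n < k then 0 else if n = 1 then 1 else ballot_number n k) +
      (if Suc n < Suc (Suc k) then 0 else if Suc n = 1 then 1 else ballot_number (Suc n) (Suc (Suc k)))"
    by cases (use k in \<open>auto simp: ballot_number_diagonal ballot_number_rec\<close>)
qed simp

section \<open>The Catalan series \<open>r * x\<close> as a power series\<close>

definition catalan_fps :: "real fps" where
  "catalan_fps = fps_const (1/2) * (1 - fps_radical root 2 (1 - 4 * fps_X))"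

text \<open>Completing the square: \<open>2 * catalan_fps = 1 - ?q\<close> with
  \<open>?q ^ 2 = 1 - 4 * fps_X\<close>. Of the two roots of \<open>w = fps_X + w ^ 2\<close> this
  is the one without constant term.\<close>

lemma catalan_fps_quadratic: "catalan_fps = fps_X + catalan_fps ^ 2"
proof -
  let ?q = "fps_radical root 2 (1 - 4 * fps_X) :: real fps"
  have "fps_to_fls (?q ^ 2) = fps_to_fls (1 - 4 * fps_X)"
    using sqrt_one_minus_4x_square
    by (simp add: sqrt_one_minus_4x_def fps_to_fls_power fls_times_fps_to_fls)
  then have q: "?q ^ 2 = 1 - 4 * fps_X" by (simp only: fps_to_fls_eq_iff)
  have h: "2 * catalan_fps = 1 - ?q"
    by (simp add: catalan_fps_def fps_numeral_fps_const flip: mult.assoc)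
  have "4 * (fps_X + catalan_fps ^ 2) = 4 * fps_X + (2 * catalan_fps) ^ 2"
    by (simp add: power_mult_distrib algebra_simps)
  also have "\<dots> = 2 * (1 - ?q)"
    unfolding h by (simp add: power2_diff q)
  also have "\<dots> = 4 * catalan_fps" unfolding h [symmetric] by simp
  finally show ?thesis
    by (metis mult_left_cancel zero_neq_numeral)
qed

lemma catalan_fps_nth_0: "fps_nth catalan_fps 0 = 0"
  by (simp add: catalan_fps_def numeral_2_eq_2)

lemma fps_to_fls_catalan: "fps_to_fls catalan_fps = (1 - sqrt_one_minus_4x) / 2"
proof -
  have "2 * catalan_fps = 1 - fps_radical root 2 (1 - 4 * fps_X)"
    by (simp add: catalan_fps_def fps_numeral_fps_const flip: mult.assoc)
  then have "fps_to_fls (2 * catalan_fps) = fps_to_fls (1 - fps_radical root 2 (1 - 4 * fps_X))"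
    by simp
  then show ?thesis
    by (simp add: sqrt_one_minus_4x_def fls_times_fps_to_fls field_simps)
qed

section \<open>Coefficients and closed forms of the generating function\<close>

lemma stanley_gf_nth:
  "fps_nth stanley_gf k = fps_to_fls (Abs_fps (\<lambda>n. real (card (anchored_rows n k))))"
  using bij_betw_same_card [OF anchored_rows_bij_betw] by (simp add: stanley_gf_def)

lemma stanley_gf_nth_0: "fps_nth stanley_gf 0 = 0"
proof -
  have "anchored_rows n 0 = {}" for n
    by (auto simp: anchored_rows_def stanley_rows_def hd_conv_nth)
  then show ?thesis
    by (simp add: stanley_gf_nth fls_eq_iff)
qed

lemma stanley_gf_nth_pos:
  assumes "k \<ge> 1"
  shows "fps_nth stanley_gf k = fls_X * ((1 - sqrt_one_minus_4x) / 2) ^ (k - 1)"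
proof -
  have "Abs_fps (\<lambda>n. real (card (anchored_rows n k))) = fps_X * catalan_fps ^ (k - 1)"
    using ballot_recurrence_unique [OF ballot_recurrence_card
        ballot_recurrence_fps [OF catalan_fps_quadratic catalan_fps_nth_0] assms]
    by (simp add: fps_eq_iff)
  then show ?thesis
    by (simp add: stanley_gf_nth fls_times_fps_to_fls fps_to_fls_power fps_to_fls_catalan)
qed

lemma stanley_gf_nth_nth:
  assumes "n \<ge> 2" "1 \<le> k" "k \<le> n"
  shows "fls_nth (fps_nth stanley_gf k) (int n) = ballot_number n k"
  using assms ballot_recurrence_unique [OF ballot_recurrence_card ballot_recurrence_ballot_number assms(2), of n]
  by (simp add: stanley_gf_nth)

text \<open>For \<open>a = r * x\<close> and \<open>b = s * x\<close> the left side is the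
  denominator of the second closed form, equal to \<open>2 * (1 - a * u) * (1 - b * u)\<close>; the
  factor \<open>2 - u - q * u\<close> is \<open>2 * (1 - b * u)\<close> and also occurs in the
  numerator.\<close>

lemma quadratic_factorization:
  fixes a b c q u :: "'a :: comm_ring_1"
  assumes "a + b = 1" "a * b = c" "b + b = 1 + q"
  shows "2 * u ^ 2 * c - 2 * u + 2 = (1 - a * u) * (2 - u - q * u)"
proof -
  have q: "q = b + b - 1" and a: "a = 1 - b" using assms(1,3) by (simp_all add: algebra_simps)
  show ?thesis
    unfolding assms(2) [symmetric] q a by (simp add: algebra_simps power2_eq_square)
qed

theorem theorem2p2:
  fixes x r s :: "real fls" and u G :: "real fls fps"
  assumes "x = fls_X" and "u = fps_X" and "G = stanley_gf"
    and "r = (1 - sqrt_one_minus_4x) / (2 * x)"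
    and "s = (1 + sqrt_one_minus_4x) / (2 * x)"
  shows "G = u / (fps_const r * (fps_const s - u)) \<and>
         u / (fps_const r * (fps_const s - u)) =
           ((2 - u - fps_const sqrt_one_minus_4x * u) * fps_const x * u) /
           (2 * u ^ 2 * fps_const x - 2 * u + 2) \<and>
         (\<forall>n k. n \<ge> 2 \<and> 1 \<le> k \<and> k \<le> n \<longrightarrow>
            fps_nth G k = x * (r * x) ^ (k - 1) \<and>
            fls_nth (fps_nth G k) (int n) =
              (real k - 1) / (2 * real n - real k - 1) * real ((2 * n - k - 1) choose (n - k)))"
proof -
  define q where "q = sqrt_one_minus_4x"
  have x: "x \<noteq> 0" by (simp add: assms(1))
  have q: "q ^ 2 = 1 - 4 * x" by (simp add: q_def assms(1) sqrt_one_minus_4x_square)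
  have rx: "r * x = (1 - q) / 2" and sx: "s * x = (1 + q) / 2"
    using x by (simp_all add: assms(4,5) q_def field_simps)
  have "(r * x) * (s * x) = x"
    unfolding rx sx using q by (simp add: field_simps power2_eq_square)
  then have rsx: "r * s * x = 1"
    using x by (simp add: mult_ac)
  define D where "D = fps_const r * (fps_const s - u)"
  define E where "E = 2 * u ^ 2 * fps_const x - 2 * u + 2"
  \<comment> \<open>Nonzero constant coefficients make \<open>D\<close> and \<open>E\<close>
    nonzero, so that products can be turned into quotients.\<close>
  have D0: "fps_nth D 0 \<noteq> 0" using rsx by (auto simp: D_def assms(2))
  have E0: "fps_nth E 0 \<noteq> 0" by (simp add: E_def assms(2))
  have coeff: "fps_nth G k = x * (r * x) ^ (k - 1)" if "k \<ge> 1" for k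
    using stanley_gf_nth_pos [OF that] unfolding rx q_def assms(3) unfolding assms(1) .
  \<comment> \<open>From \<open>u ^ 1\<close> on, the coefficients of \<open>G\<close> form a
    geometric progression with ratio \<open>r * x\<close>.\<close>
  have G1: "G * (1 - fps_const (r * x) * u) = fps_const x * u"
  proof (rule fps_ext)
    fix k
    show "fps_nth (G * (1 - fps_const (r * x) * u)) k = fps_nth (fps_const x * u) k"
    proof (cases k)
      case 0
      then show ?thesis by (simp add: assms(2,3) stanley_gf_nth_0)
    next
      case (Suc j)
      have "G * (1 - fps_const (r * x) * u) = G - fps_const (r * x) * (G * u)"
        by (simp only: right_diff_distrib mult_1_right mult.left_commute)
      then have "fps_nth (G * (1 - fps_const (r * x) * u)) k = fps_nth G k - r * x * fps_nth G j"
        by (simp add: Suc assms(2))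
      also have "\<dots> = fps_nth (fps_const x * u) k"
        using coeff by (cases j) (auto simp: Suc assms(2,3) stanley_gf_nth_0)
      finally show ?thesis .
    qed
  qed
  have DX: "fps_const x * D = 1 - fps_const (r * x) * u"
    using rsx by (simp add: D_def algebra_simps flip: fps_const_mult)
  have "fps_const x * (G * D) = fps_const x * u"
    unfolding mult.left_commute [of _ G] DX by (rule G1)
  then have GD: "G * D = u" using x by (metis mult_left_cancel fps_const_eq_0_iff)
  then have 1: "G = u / D" using D0 by (metis nonzero_mult_div_cancel_right fps_zero_nth)
  \<comment> \<open>Both quotients are identified with \<open>G\<close>, the second by computing
    \<open>G * E\<close>.\<close>
  have 2: "u / D = ((2 - u - fps_const q * u) * fps_const x * u) / E"
  proof -
    have "r * x + s * x = 1" "(r * x) * (s * x) = x" "s * x + s * x = 1 + q"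
      unfolding rx sx using q by (simp_all add: field_simps power2_eq_square)
    then have "fps_const (r * x) + fps_const (s * x) = 1" "fps_const (r * x) * fps_const (s * x) = fps_const x"
        "fps_const (s * x) + fps_const (s * x) = 1 + fps_const q"
      by (metis fps_const_add fps_const_1_eq_1, metis fps_const_mult, metis fps_const_add fps_const_1_eq_1)
    then have E: "E = (1 - fps_const (r * x) * u) * (2 - u - fps_const q * u)"
      unfolding E_def by (rule quadratic_factorization)
    have "G * E = (G * (1 - fps_const (r * x) * u)) * (2 - u - fps_const q * u)"
      unfolding E by (simp only: mult.assoc)
    also have "\<dots> = (2 - u - fps_const q * u) * fps_const x * u"
      unfolding G1 by (simp only: mult_ac)
    finally have "((2 - u - fps_const q * u) * fps_const x * u) / E = G"
      using E0 by (metis nonzero_mult_div_cancel_right fps_zero_nth)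
    with 1 show ?thesis by simp
  qed
  show ?thesis
    using 1 2 coeff stanley_gf_nth_nth
    by (auto simp: D_def E_def q_def ballot_number_def assms(3))
qed

end
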